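(* Let $K$ be a finite $n$-dimensional well-centered oriented manifold-like simplicial complex with boundary $\partial K$, let $0\le k\le n-1$, and let $Q=\Omega^k(K)$, $Q^\ast=\Omega^{n-k}(\star_i K)$, $F^\ast=\Omega^k(\partial(K))$, $F=\Omega^{n-k-1}(\partial(\star K))$. Let the generalized canonical Poisson map $\sharp$ on $T^\ast Q\times F^\ast$ be given at each base point by $$\sharp(e_\rho,e_\pi,e_b)=\big(e_\pi,\ -(-1)^{k(n-k)}(e_\rho+\mathbf d_b^{\,n-k-1}e_b),\ -\mathbf{tr}^k e_\pi\big),$$ let $\pi_G(\rho,\pi,\rho_b)=(\mathbf d^k\rho,\pi,\rho_b)$ be the quotient map onto $T^\ast Q/G\times F^\ast=\mathbf d^k\Omega^k(K)\times\Omega^{n-k}(\star_iK)\times\Omega^k(\partial(K))$, and let the reduced simplicial Poisson structure be $[\sharp]=T\pi_G\circ\sharp\circ T^\ast\pi_G$, where $T^\ast\pi_G$ is the adjoint of the tangent map $T\pi_G$ with respect to the duality pairings specified in the context. Then for all $\bar e_\rho\in\Omega^{n-k-1}(\star_iK)$, $\bar e_\pi\in\Omega^k(K)$, $\bar e_b\in\Omega^{n-k-1}(\partial(\star K))$, $$[\sharp](\bar e_\rho,\bar e_\pi,\bar e_b)=\Big(\mathbf d^k\bar e_\pi,\ -(-1)^{k(n-k)}\big((-1)^{n-k}\mathbf d_i^{\,n-k-1}\bar e_\rho+\mathbf d_b^{\,n-k-1}\bar e_b\big),\ -\mathbf{tr}^k\bar e_\pi\Big).$$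
   Context: Discrete forms: $\Omega^j(K)$ is the space of real $j$-cochains on $K$ (primal discrete forms). $\Omega^{n-j}(\star_iK)$ is the space of real-valued functions on the circumcentric dual $(n-j)$-cells $\star\sigma^j$ of the $j$-simplices $\sigma^j$ of $K$ (interior dual forms). $\Omega^j(\partial(K))$ is the space of $j$-cochains on $\partial K$. $\Omega^{n-1-j}(\partial(\star K))$ is the space of real-valued functions on the $(n-1-j)$-cells dual, within $\partial K$, to the $j$-simplices of $\partial K$. Bases are indexed by simplices and their dual cells, so $\Omega^j(K)$ and $\Omega^{n-j}(\star_iK)$ have the same dimension, and similarly on the boundary. Primal-dual wedge product: for $\alpha\in\Omega^j(K)$ and $\hat\beta\in\Omega^{n-j}(\star_iK)$, $\int_M\alpha\wedge\hat\beta:=\langle\alpha\wedge\hat\beta,K\rangle=\sum_{\sigma^j}\alpha(\sigma^j)\hat\beta(\star\sigma^j)$ and $\hat\beta\wedge\alpha=(-1)^{j(n-j)}\alpha\wedge\hat\beta$. The boundary pairing, written $\int_{\partial M}$, is defined in the same way on $\partial K$ with $n$ replaced by $n-1$. Operators: $\mathbf d^j:\Omega^j(K)\to\Omega^{j+1}(K)$ is the discrete exterior derivative (coboundary), and $\mathbf{tr}^k:\Omega^k(K)\to\Omega^k(\partial(K))$ is the restriction to $\partial K$. In the bases above, $\mathbf d_i^{\,n-k-1}=(-1)^{k+1}(\mathbf d^k)^{T}:\Omega^{n-k-1}(\star_iK)\to\Omega^{n-k}(\star_iK)$ is the dual discrete exterior derivative, and $\mathbf d_b^{\,n-k-1}=(-1)^{k}(\mathbf{tr}^k)^{T}:\Omega^{n-k-1}(\partial(\star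 K))\to\Omega^{n-k}(\star_iK)$. Spaces and pairings: a point of $T^\ast Q\times F^\ast$ is $(\rho,\pi,\rho_b)\in Q\times Q^\ast\times F^\ast$. Tangent vectors are $(\dot\rho,\dot\pi,\dot\rho_b)\in Q\times Q^\ast\times F^\ast$ and covectors are $(e_\rho,e_\pi,e_b)\in Q^\ast\times Q\times F$ (base points suppressed), paired by $$\langle(e_\rho,e_\pi,e_b),(\dot\rho,\dot\pi,\dot\rho_b)\rangle=\int_M(e_\rho\wedge\dot\rho+e_\pi\wedge\dot\pi)+\int_{\partial M}e_b\wedge\dot\rho_b.$$ The group $G$ of discrete $(k-1)$-forms acts on $Q$ by $\rho\mapsto\rho+\mathbf d^{k-1}\alpha$. The reduced space is taken to be $T^\ast Q/G\times F^\ast=\mathbf d^k\Omega^k(K)\times\Omega^{n-k}(\star_iK)\times\Omega^k(\partial(K))$ with quotient map $\pi_G(\rho,\pi,\rho_b)=(\mathbf d^k\rho,\pi,\rho_b)$. On the reduced space, tangent vectors are $(\dot{\bar\rho},\dot{\bar\pi},\dot{\bar\rho}_b)$ with $\dot{\bar\rho}\in\mathbf d^k\Omega^k(K)$, $\dot{\bar\pi}\in\Omega^{n-k}(\star_iK)$, $\dot{\bar\rho}_b\in\Omega^k(\partial(K))$. Covectors are represented by $(\bar e_\rho,\bar e_\pi,\bar e_b)\in\Omega^{n-k-1}(\star_iK)\times\Omega^k(K)\times\Omega^{n-k-1}(\partial(\star K))$, with pairing $$\langle(\bar e_\rho,\bar e_\pi,\bar e_b),(\dot{\bar\rho},\dot{\bar\pi},\dot{\bar\rho}_b)\rangle=\int_M(\bar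 e_\rho\wedge\dot{\bar\rho}+\bar e_\pi\wedge\dot{\bar\pi})+\int_{\partial M}\bar e_b\wedge\dot{\bar\rho}_b.$$ The adjoint is defined by $\langle T^\ast\pi_G(\bar e),v\rangle=\langle\bar e,T\pi_G(v)\rangle$ for all tangent vectors $v$. *)

theory Defs
  imports "HOL-Analysis.Analysis" "HOL-Combinatorics.Permutations"
begin

section \<open>The simplicial complex\<close>

definition simplices :: "'a::euclidean_space set set \<Rightarrow> nat \<Rightarrow> 'a set set" where
  "simplices K j = {S \<in> K. int j simplex S}"

definition circumcenter :: "'a::euclidean_space set \<Rightarrow> 'a" where
  "circumcenter S = (THE c. c \<in> affine hull S \<and> (\<exists>r. \<forall>v. v extreme_point_of S \<longrightarrow> dist c v = r))"

definition well_centered :: "'a::euclidean_space set set \<Rightarrow> bool" where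
  "well_centered K \<longleftrightarrow> (\<forall>S\<in>K. S \<noteq> {} \<longrightarrow> circumcenter S \<in> rel_interior S)"

text \<open>Every simplex is a face of an \<open>n\<close>-simplex, and the polyhedron is a topological
  \<open>n\<close>-manifold, possibly with boundary.\<close>

definition manifold_like :: "nat \<Rightarrow> 'a::euclidean_space set set \<Rightarrow> bool" where
  "manifold_like n K \<longleftrightarrow>
     simplices K n \<noteq> {} \<and>
     (\<forall>S\<in>K. \<exists>T\<in>simplices K n. S face_of T) \<and>
     (\<forall>x\<in>\<Union>K. \<exists>U. openin (top_of_set (\<Union>K)) U \<and> x \<in> U \<and>
        (top_of_set U homeomorphic_space Euclidean_space n \<or>
         top_of_set U homeomorphic_space subtopology (Euclidean_space n) {y. 0 \<le> y 0}))"

text \<open>The boundary complex consists of the faces of those \<open>(n-1)\<close>-simplices that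
  lie in exactly one \<open>n\<close>-simplex.\<close>

definition boundary_complex :: "nat \<Rightarrow> 'a::euclidean_space set set \<Rightarrow> 'a set set" where
  "boundary_complex n K =
     {F. \<exists>S\<in>simplices K (n - 1). (\<exists>!T. T \<in> simplices K n \<and> S face_of T) \<and> F face_of S}"

section \<open>Cochains and orientations\<close>

text \<open>An orientation of a simplex is an ordering of its vertices, up to even permutations;
  \<open>ori S\<close> is a representative. A cochain is given by its values on the simplices with their
  chosen orientations; it is extended by zero outside its index set, so that cochains on a
  subcomplex (which inherits the orientations) are functions on the same type.
  Since \<open>\<star>S\<close> carries the orientation determined by those of \<open>S\<close> and \<open>K\<close>, dual forms are
  similarly functions of the (unoriented) dual cells.\<close>

type_synonym 'a form = "'a set \<Rightarrow> real"

definition forms :: "'a set set \<Rightarrow> 'a form set" where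
  "forms A = {f. \<forall>c. c \<notin> A \<longrightarrow> f c = 0}"

text \<open>The value of \<open>\<alpha>\<close> on the oriented simplex \<open>[v\<^sub>0, \<dots>, v\<^sub>j]\<close> with an arbitrary ordering.\<close>

definition on_oriented :: "('a::euclidean_space set \<Rightarrow> 'a list) \<Rightarrow> 'a form \<Rightarrow> 'a list \<Rightarrow> real" where
  "on_oriented ori \<alpha> vs =
     (let S = convex hull (set vs) in
      of_int (sign (THE p. p permutes {..<length vs} \<and> permute_list p (ori S) = vs)) * \<alpha> S)"

definition coboundary ::
  "'a::euclidean_space set set \<Rightarrow> ('a set \<Rightarrow> 'a list) \<Rightarrow> nat \<Rightarrow> 'a form \<Rightarrow> 'a form" where
  "coboundary K ori j \<alpha> = (\<lambda>T. if T \<in> simplices K (Suc j)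
     then \<Sum>i\<le>Suc j. (-1) ^ i * on_oriented ori \<alpha> (take i (ori T) @ drop (Suc i) (ori T))
     else 0)"

text \<open>Besides orienting each simplex, \<open>ori\<close> orients the \<open>n\<close>-simplices coherently: any two
  sharing an \<open>(n-1)\<close>-face induce opposite orientations on it. The incidence number of
  \<open>S\<close> in \<open>T\<close> is the value on \<open>T\<close> of the coboundary of the basis cochain of \<open>S\<close>.\<close>

definition oriented :: "nat \<Rightarrow> 'a::euclidean_space set set \<Rightarrow> ('a set \<Rightarrow> 'a list) \<Rightarrow> bool" where
  "oriented n K ori \<longleftrightarrow>
     (\<forall>S\<in>K. distinct (ori S) \<and> set (ori S) = {v. v extreme_point_of S}) \<and>
     (\<forall>S\<in>simplices K (n - 1). \<forall>T\<in>simplices K n. \<forall>T'\<in>simplices K n.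
        S face_of T \<and> S face_of T' \<and> T \<noteq> T' \<longrightarrow>
        coboundary K ori (n - 1) (indicator {S}) T = - coboundary K ori (n - 1) (indicator {S}) T')"

definition bd_trace :: "'a::euclidean_space set set \<Rightarrow> nat \<Rightarrow> nat \<Rightarrow> 'a form \<Rightarrow> 'a form" where
  "bd_trace K n j \<alpha> = (\<lambda>S. if S \<in> simplices (boundary_complex n K) j then \<alpha> S else 0)"

section \<open>Circumcentric duals\<close>

text \<open>The dual cell of \<open>S\<close> within the complex \<open>L\<close> is the union of the open simplices
  spanned by the circumcenters of the flags of \<open>L\<close> that start at \<open>S\<close>. For a simplex of the
  boundary, its dual in \<open>K\<close> and its dual within the boundary are different cells.\<close>

definition dual_cell :: "'a::euclidean_space set set \<Rightarrow> 'a set \<Rightarrow> 'a set" where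
  "dual_cell L S = \<Union> {rel_interior (convex hull (circumcenter ` C)) | C.
     C \<subseteq> L \<and> S \<in> C \<and> (\<forall>T\<in>C. S face_of T) \<and> (\<forall>T\<in>C. \<forall>T'\<in>C. T face_of T' \<or> T' face_of T)}"

abbreviation primal_forms :: "'a::euclidean_space set set \<Rightarrow> nat \<Rightarrow> 'a form set" where
  "primal_forms L j \<equiv> forms (simplices L j)"

text \<open>Dual forms are indexed by the degree \<open>j\<close> of the primal simplices, i.e. for an
  \<open>m\<close>-dimensional complex \<open>L\<close>, \<open>dual_forms L j\<close> consists of forms of degree \<open>m - j\<close>.\<close>

abbreviation dual_forms :: "'a::euclidean_space set set \<Rightarrow> nat \<Rightarrow> 'a form set" where
  "dual_forms L j \<equiv> forms (dual_cell L ` simplices L j)"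

text \<open>Integrals over an \<open>m\<close>-dimensional complex \<open>L\<close> of \<open>\<alpha> \<and> \<beta>\<close> and \<open>\<beta> \<and> \<alpha>\<close>, for a primal
  \<open>j\<close>-form \<open>\<alpha>\<close> and a dual \<open>(m-j)\<close>-form \<open>\<beta>\<close>.\<close>

definition wedge_pd :: "'a::euclidean_space set set \<Rightarrow> nat \<Rightarrow> 'a form \<Rightarrow> 'a form \<Rightarrow> real" where
  "wedge_pd L j \<alpha> \<beta> = (\<Sum>S\<in>simplices L j. \<alpha> S * \<beta> (dual_cell L S))"

definition wedge_dp ::
  "'a::euclidean_space set set \<Rightarrow> nat \<Rightarrow> nat \<Rightarrow> 'a form \<Rightarrow> 'a form \<Rightarrow> real" where
  "wedge_dp L m j \<beta> \<alpha> = (-1) ^ (j * (m - j)) * wedge_pd L j \<alpha> \<beta>"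

text \<open>Let \<open>M\<close> be the matrix of the operator \<open>A\<close> in the bases indexed by \<open>I\<close> and \<open>J\<close>. The
  transpose is the operator with matrix \<open>M\<^sup>T\<close> in the bases indexed by the cells \<open>s ` I\<close>
  and \<open>t ` J\<close> dual to \<open>I\<close> and \<open>J\<close>: it maps \<open>\<beta>\<close> to
  \<open>\<Sum>S\<in>I. (\<Sum>T\<in>J. M\<^bsub>TS\<^esub> \<beta>(t T)) e\<^bsub>s S\<^esub>\<close>.\<close>

definition transpose_op ::
  "'a set set \<Rightarrow> ('a set \<Rightarrow> 'a set) \<Rightarrow> 'a set set \<Rightarrow> ('a set \<Rightarrow> 'a set) \<Rightarrow>
   ('a form \<Rightarrow> 'a form) \<Rightarrow> 'a form \<Rightarrow> 'a form" where
  "transpose_op I s J t A \<beta> =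
     (\<lambda>c. \<Sum>S\<in>I. (\<Sum>T\<in>J. A (indicator {S}) T * \<beta> (t T)) * indicator {s S} c)"

definition dual_d ::
  "'a::euclidean_space set set \<Rightarrow> ('a set \<Rightarrow> 'a list) \<Rightarrow> nat \<Rightarrow> 'a form \<Rightarrow> 'a form" where
  "dual_d K ori k \<beta> = (\<lambda>c. (-1) ^ (k + 1) *
     transpose_op (simplices K k) (dual_cell K) (simplices K (Suc k)) (dual_cell K)
       (coboundary K ori k) \<beta> c)"

definition boundary_d ::
  "'a::euclidean_space set set \<Rightarrow> nat \<Rightarrow> nat \<Rightarrow> 'a form \<Rightarrow> 'a form" where
  "boundary_d K n k \<beta> = (\<lambda>c. (-1) ^ k *
     transpose_op (simplices K k) (dual_cell K)
       (simplices (boundary_complex n K) k) (dual_cell (boundary_complex n K))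
       (bd_trace K n k) \<beta> c)"

section \<open>Poisson structures\<close>

type_synonym 'a form3 = "'a form \<times> 'a form \<times> 'a form"

text \<open>\<open>T\<^sup>*Q \<times> F\<^sup>*\<close>, which as a vector space is also its tangent space at each point.\<close>

definition phase_space :: "'a::euclidean_space set set \<Rightarrow> nat \<Rightarrow> nat \<Rightarrow> 'a form3 set" where
  "phase_space K n k =
     primal_forms K k \<times> dual_forms K k \<times> primal_forms (boundary_complex n K) k"

definition covectors :: "'a::euclidean_space set set \<Rightarrow> nat \<Rightarrow> nat \<Rightarrow> 'a form3 set" where
  "covectors K n k =
     dual_forms K k \<times> primal_forms K k \<times> dual_forms (boundary_complex n K) k"

definition reduced_space ::
  "'a::euclidean_space set set \<Rightarrow> ('a set \<Rightarrow> 'a list) \<Rightarrow> nat \<Rightarrow> nat \<Rightarrow> 'a form3 set" where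
  "reduced_space K ori n k =
     coboundary K ori k ` primal_forms K k \<times> dual_forms K k \<times> primal_forms (boundary_complex n K) k"

definition pairing ::
  "'a::euclidean_space set set \<Rightarrow> nat \<Rightarrow> nat \<Rightarrow> 'a form3 \<Rightarrow> 'a form3 \<Rightarrow> real" where
  "pairing K n k = (\<lambda>(e\<^sub>\<rho>, e\<^sub>\<pi>, e\<^sub>b) (v\<^sub>\<rho>, v\<^sub>\<pi>, v\<^sub>b).
     wedge_dp K n k e\<^sub>\<rho> v\<^sub>\<rho> + wedge_pd K k e\<^sub>\<pi> v\<^sub>\<pi> +
     wedge_dp (boundary_complex n K) (n - 1) k e\<^sub>b v\<^sub>b)"

definition reduced_pairing ::
  "'a::euclidean_space set set \<Rightarrow> nat \<Rightarrow> nat \<Rightarrow> 'a form3 \<Rightarrow> 'a form3 \<Rightarrow> real" where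
  "reduced_pairing K n k = (\<lambda>(e\<^sub>\<rho>, e\<^sub>\<pi>, e\<^sub>b) (v\<^sub>\<rho>, v\<^sub>\<pi>, v\<^sub>b).
     wedge_dp K n (Suc k) e\<^sub>\<rho> v\<^sub>\<rho> + wedge_pd K k e\<^sub>\<pi> v\<^sub>\<pi> +
     wedge_dp (boundary_complex n K) (n - 1) k e\<^sub>b v\<^sub>b)"

definition pi_G ::
  "'a::euclidean_space set set \<Rightarrow> ('a set \<Rightarrow> 'a list) \<Rightarrow> nat \<Rightarrow> 'a form3 \<Rightarrow> 'a form3" where
  "pi_G K ori k = (\<lambda>(\<rho>, \<pi>, \<rho>\<^sub>b). (coboundary K ori k \<rho>, \<pi>, \<rho>\<^sub>b))"

lemma pi_G_image: "pi_G K ori k ` phase_space K n k = reduced_space K ori n k"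
  by (force simp: pi_G_def phase_space_def reduced_space_def image_iff)

text \<open>The tangent map of \<open>f\<close> at \<open>x\<close>, in the direction \<open>v\<close>, taken coordinatewise.\<close>

definition tangent_map :: "('a form3 \<Rightarrow> 'a form3) \<Rightarrow> 'a form3 \<Rightarrow> 'a form3 \<Rightarrow> 'a form3" where
  "tangent_map f = (\<lambda>(\<rho>, \<pi>, \<rho>\<^sub>b) (v\<^sub>\<rho>, v\<^sub>\<pi>, v\<^sub>b).
     let \<gamma> = (\<lambda>t::real. f (\<lambda>c. \<rho> c + t * v\<^sub>\<rho> c, \<lambda>c. \<pi> c + t * v\<^sub>\<pi> c, \<lambda>c. \<rho>\<^sub>b c + t * v\<^sub>b c)) in
     (\<lambda>c. deriv (\<lambda>t. fst (\<gamma> t) c) 0,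
      \<lambda>c. deriv (\<lambda>t. fst (snd (\<gamma> t)) c) 0,
      \<lambda>c. deriv (\<lambda>t. snd (snd (\<gamma> t)) c) 0))"

text \<open>The adjoint of the tangent map of \<open>pi_G\<close> at \<open>x\<close>.\<close>

definition cotangent_pi_G ::
  "'a::euclidean_space set set \<Rightarrow> ('a set \<Rightarrow> 'a list) \<Rightarrow> nat \<Rightarrow> nat \<Rightarrow> 'a form3 \<Rightarrow> 'a form3 \<Rightarrow> 'a form3"
  where
  "cotangent_pi_G K ori n k x e' = (THE e. e \<in> covectors K n k \<and>
     (\<forall>v\<in>phase_space K n k.
        pairing K n k e v = reduced_pairing K n k e' (tangent_map (pi_G K ori k) x v)))"

text \<open>The generalized canonical Poisson map; it does not depend on the base point.\<close>

definition sharp :: "'a::euclidean_space set set \<Rightarrow> nat \<Rightarrow> nat \<Rightarrow> 'a form3 \<Rightarrow> 'a form3" where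
  "sharp K n k = (\<lambda>(e\<^sub>\<rho>, e\<^sub>\<pi>, e\<^sub>b).
     (e\<^sub>\<pi>, \<lambda>c. - ((-1) ^ (k * (n - k)) * (e\<^sub>\<rho> c + boundary_d K n k e\<^sub>b c)), \<lambda>c. - bd_trace K n k e\<^sub>\<pi> c))"

text \<open>The reduced Poisson map at the point \<open>pi_G K ori k x\<close>, computed at the representative \<open>x\<close>.\<close>

definition reduced_sharp ::
  "'a::euclidean_space set set \<Rightarrow> ('a set \<Rightarrow> 'a list) \<Rightarrow> nat \<Rightarrow> nat \<Rightarrow> 'a form3 \<Rightarrow> 'a form3 \<Rightarrow> 'a form3"
  where
  "reduced_sharp K ori n k x =
     tangent_map (pi_G K ori k) x \<circ> sharp K n k \<circ> cotangent_pi_G K ori n k x"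

end

theory Submission
  imports Defs
begin

text \<open>By linearity, the tangent map of the quotient map is the quotient map itself, at every base
  point. Its adjoint is then found by expanding primal forms in the basis of simplices; this needs
  that distinct \<open>k\<close>-simplices have distinct dual cells. If \<open>\<star>S = \<star>S'\<close>, then the circumcenter of
  \<open>S\<close> lies in the open simplex spanned by the circumcenters of a flag starting at \<open>S'\<close>. By
  well-centeredness, this open simplex is contained in the relative interior of the largest member
  of the flag, which is therefore \<open>S\<close>, so \<open>S'\<close> is a face of \<open>S\<close>, and they have equal dimension.\<close>

section \<open>Injectivity of the circumcentric duality\<close>

lemma finite_simplices: "simplicial_complex K \<Longrightarrow> finite (simplices K j)"
  by (simp add: simplices_def simplicial_complex_def)

lemma finite_boundary_simplices:
  assumes "simplicial_complex K"
  shows "finite (simplices (boundary_complex n K) j)"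
proof (rule finite_subset)
  show "simplices (boundary_complex n K) j \<subseteq> K"
    using assms by (auto simp: simplices_def boundary_complex_def simplicial_complex_def)
  show "finite K"
    using assms by (simp add: simplicial_complex_def)
qed

lemma simplex_nonempty: "int j simplex S \<Longrightarrow> S \<noteq> {}"
  by (auto simp: simplex_def)

lemma simplicial_complex_convex:
  assumes "simplicial_complex K" "S \<in> K"
  shows "convex S"
  using assms by (auto simp: simplicial_complex_def dest: convex_simplex)

text \<open>Two simplices of the complex meet in a common face, and a face that meets the relative
  interior of a convex set is the whole set.\<close>

lemma rel_interior_disjoint:
  assumes K: "simplicial_complex K" and S: "S \<in> K" and T: "T \<in> K"
    and x: "x \<in> rel_interior S" "x \<in> rel_interior T"
  shows "S = T"
proof -
  have "(S \<inter> T) face_of S" "(S \<inter> T) face_of T"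
    using K S T unfolding simplicial_complex_def by (blast, metis Int_commute)
  moreover have "x \<in> S \<inter> T"
    using x rel_interior_subset by blast
  ultimately have "S \<inter> T = S" "S \<inter> T = T"
    using x by (meson disjoint_iff face_of_disjoint_rel_interior)+
  then show ?thesis by simp
qed

text \<open>The one-element flag \<open>{S}\<close> contributes its circumcenter, since a single
  point is its own relative interior.\<close>

lemma circumcenter_in_dual_cell:
  assumes "S \<in> K" "convex S"
  shows "circumcenter S \<in> dual_cell K S"
proof -
  have "circumcenter S \<in> rel_interior (convex hull (circumcenter ` {S}))"
    by simp
  moreover have "rel_interior (convex hull (circumcenter ` {S})) \<subseteq> dual_cell K S"
    unfolding dual_cell_def using assms
    by (intro Union_upper CollectI exI[of _ "{S}"]) (simp add: face_of_refl)
  ultimately show ?thesis ..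
qed

lemma dual_cell_in_rel_interior:
  assumes K: "simplicial_complex K" and wc: "well_centered K" and S: "S \<noteq> {}"
    and x: "x \<in> dual_cell K S"
  obtains T where "T \<in> K" "S face_of T" "x \<in> rel_interior T"
proof -
  obtain C where C: "C \<subseteq> K" "S \<in> C" "\<And>T. T \<in> C \<Longrightarrow> S face_of T"
      "\<And>T T'. T \<in> C \<Longrightarrow> T' \<in> C \<Longrightarrow> T face_of T' \<or> T' face_of T"
    and xC: "x \<in> rel_interior (convex hull (circumcenter ` C))"
    using x unfolding dual_cell_def by blast
  have "finite C"
    using C K finite_subset by (auto simp: simplicial_complex_def)
  then obtain T where T: "T \<in> C" "\<And>T'. T' \<in> C \<Longrightarrow> T \<subseteq> T' \<Longrightarrow> T' = T"
    using C(2) finite_has_maximal[of C] by blast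
  \<comment> \<open>The members of the flag are pairwise comparable, so a maximal one is the
    largest.\<close>
  have sub: "T' \<subseteq> T" if "T' \<in> C" for T'
    using C(4)[OF that T(1)] T(2)[OF that] face_of_imp_subset by blast
  have cc: "circumcenter T' \<in> rel_interior T'" if "T' \<in> C" for T'
  proof -
    \<comment> \<open>Well-centeredness concerns nonempty simplices only; \<open>T'\<close> is
      nonempty because it contains \<open>S\<close>.\<close>
    have "T' \<in> K" "T' \<noteq> {}"
      using that C(1) face_of_imp_subset[OF C(3)[OF that]] S by auto
    with wc show ?thesis by (simp add: well_centered_def)
  qed
  have "convex T"
    using K T(1) C(1) simplicial_complex_convex by blast
  moreover have "convex hull (circumcenter ` C) \<subseteq> closure T"
  proof (rule order_trans[OF hull_minimal closure_subset])
    show "circumcenter ` C \<subseteq> T"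
    proof (rule image_subsetI)
      fix T' assume "T' \<in> C"
      then show "circumcenter T' \<in> T"
        using cc[of T'] sub[of T'] rel_interior_subset[of T'] by auto
    qed
  qed fact
  \<comment> \<open>The circumcenter of \<open>T\<close> itself keeps the hull off the frontier; a
    convex subset of the closure with this property has its relative interior inside that of
    \<open>T\<close>.\<close>
  moreover have "\<not> convex hull (circumcenter ` C) \<subseteq> rel_frontier T"
    using cc[OF T(1)] T(1) hull_inc[of "circumcenter T" "circumcenter ` C" convex]
    by (auto simp: rel_frontier_def)
  ultimately have "x \<in> rel_interior T"
    using xC subset_rel_interior_convex[of "convex hull (circumcenter ` C)" T]
    by auto
  with T(1) C that show ?thesis by blast
qed

lemma inj_on_dual_cell:
  assumes K: "simplicial_complex K" and wc: "well_centered K"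
  shows "inj_on (dual_cell K) (simplices K j)"
proof (rule inj_onI)
  fix S S'
  assume S: "S \<in> simplices K j" and S': "S' \<in> simplices K j"
    and eq: "dual_cell K S = dual_cell K S'"
  have SK: "S \<in> K" "int j simplex S" "S \<noteq> {}" and SK': "S' \<in> K" "int j simplex S'" "S' \<noteq> {}"
    using S S' simplex_nonempty by (auto simp: simplices_def)
  have conv: "convex S"
    using K SK simplicial_complex_convex by blast
  have "circumcenter S \<in> dual_cell K S'"
    using circumcenter_in_dual_cell[OF SK(1) conv] eq by simp
  then obtain T where T: "T \<in> K" "S' face_of T" "circumcenter S \<in> rel_interior T"
    using dual_cell_in_rel_interior[OF K wc SK'(3)] by blast
  have "circumcenter S \<in> rel_interior S"
    using wc SK by (auto simp: well_centered_def)
  with T have face: "S' face_of S"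
    using rel_interior_disjoint[OF K SK(1) T(1)] by blast
  \<comment> \<open>A proper face would have strictly smaller dimension.\<close>
  have "aff_dim S' = aff_dim S"
    using SK(2) SK'(2) by (simp add: aff_dim_simplex)
  then show "S = S'"
    using face_of_aff_dim_lt[OF conv face] by auto
qed

section \<open>Linearity\<close>

text \<open>The combination \<open>f + t * g\<close> is the line along which
  \<open>tangent_map\<close> differentiates; it also serves as the induction step for finite
  sums.\<close>

lemma coboundary_add_scale:
  "coboundary K ori j (\<lambda>c. f c + t * g c) T = coboundary K ori j f T + t * coboundary K ori j g T"
  by (simp add: coboundary_def on_oriented_def Let_def algebra_simps sum.distrib sum_distrib_left)

lemma coboundary_sum:
  "finite I \<Longrightarrow> coboundary K ori j (\<lambda>c. \<Sum>i\<in>I. a i * f i c) T = (\<Sum>i\<in>I. a i * coboundary K ori j (f i) T)"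
proof (induction I rule: finite_induct)
  case empty
  then show ?case by (simp add: coboundary_def on_oriented_def)
next
  case (insert i I)
  then show ?case
    using coboundary_add_scale[of K ori j "\<lambda>c. \<Sum>i\<in>I. a i * f i c" "a i" "f i" T]
    by (simp add: add.commute)
qed

lemma forms_expand:
  assumes "finite I" "v \<in> forms I"
  shows "v = (\<lambda>c. \<Sum>S\<in>I. v S * indicator {S} c)"
proof
  fix c
  have "(\<Sum>S\<in>I. v S * indicator {S} c) = (\<Sum>S\<in>I. if S = c then v S else 0)"
    by (intro sum.cong) (auto simp: indicator_def)
  then show "v c = (\<Sum>S\<in>I. v S * indicator {S} c)"
    using assms by (auto simp: forms_def)
qed

lemma coboundary_expand:
  assumes "finite (simplices K j)" "v \<in> primal_forms K j"
  shows "coboundary K ori j v T = (\<Sum>S\<in>simplices K j. v S * coboundary K ori j (indicator {S}) T)"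
  using coboundary_sum[OF assms(1), of K ori j v "\<lambda>S. indicator {S}" T]
  by (simp flip: forms_expand[OF assms])

lemma deriv_affine: "deriv (\<lambda>t. a + t * b) (0::real) = b"
  by (rule DERIV_imp_deriv) (auto intro!: derivative_eq_intros)

text \<open>Each coordinate of the quotient map along a line is affine in the parameter, and its
  slope is the same coordinate of the image of \<open>v\<close>.\<close>

lemma tangent_map_pi_G: "tangent_map (pi_G K ori k) x v = pi_G K ori k v"
  by (simp add: tangent_map_def pi_G_def split_beta Let_def coboundary_add_scale deriv_affine)

section \<open>The adjoint of the tangent map\<close>

text \<open>Injectivity of \<open>s\<close> leaves a single contribution at the cell
  \<open>s S\<close>; coefficients of coinciding cells would add up.\<close>

lemma transpose_op_at:
  assumes "finite I" "inj_on s I" "S \<in> I"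
  shows "transpose_op I s J t A \<beta> (s S) = (\<Sum>T\<in>J. A (indicator {S}) T * \<beta> (t T))"
proof -
  have "transpose_op I s J t A \<beta> (s S) =
      (\<Sum>S'\<in>I. if S' = S then (\<Sum>T\<in>J. A (indicator {S'}) T * \<beta> (t T)) else 0)"
    unfolding transpose_op_def using assms
    by (intro sum.cong) (auto simp: indicator_def inj_on_eq_iff)
  with assms show ?thesis by simp
qed

lemma transpose_op_in_forms: "transpose_op I s J t A \<beta> \<in> forms (s ` I)"
  by (auto simp: forms_def transpose_op_def indicator_def intro!: sum.neutral)

lemma wedge_pd_scale: "wedge_pd L j \<alpha> (\<lambda>c. r * \<beta> c) = r * wedge_pd L j \<alpha> \<beta>"
  by (simp add: wedge_pd_def sum_distrib_left mult.left_commute)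

text \<open>Summation by parts: expanding \<open>v\<close> in basis cochains and exchanging the two
  sums moves the coboundary onto \<beta> as its transpose.\<close>

lemma wedge_pd_coboundary:
  assumes "finite (simplices K k)" "inj_on (dual_cell K) (simplices K k)" "v \<in> primal_forms K k"
  shows "wedge_pd K (Suc k) (coboundary K ori k v) \<beta> = (-1) ^ (k + 1) * wedge_pd K k v (dual_d K ori k \<beta>)"
proof -
  let ?M = "\<lambda>S T. coboundary K ori k (indicator {S}) T"
  have "wedge_pd K (Suc k) (coboundary K ori k v) \<beta> =
      (\<Sum>T\<in>simplices K (Suc k). \<Sum>S\<in>simplices K k. v S * (?M S T * \<beta> (dual_cell K T)))"
    unfolding wedge_pd_def coboundary_expand[OF assms(1,3)] sum_distrib_right by (simp add: mult.assoc)
  also have "\<dots> = (\<Sum>S\<in>simplices K k. v S * (\<Sum>T\<in>simplices K (Suc k). ?M S T * \<beta> (dual_cell K T)))"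
    by (subst sum.swap) (simp add: sum_distrib_left)
  also have "\<dots> = wedge_pd K k v (transpose_op (simplices K k) (dual_cell K)
      (simplices K (Suc k)) (dual_cell K) (coboundary K ori k) \<beta>)"
    unfolding wedge_pd_def by (intro sum.cong) (simp_all add: transpose_op_at assms)
  \<comment> \<open>The sign in front cancels the equal sign built into
    \<open>dual_d\<close>.\<close>
  also have "\<dots> = (-1) ^ (k + 1) * wedge_pd K k v (dual_d K ori k \<beta>)"
    unfolding dual_d_def wedge_pd_scale by (cases "even k") simp_all
  finally show ?thesis .
qed

section \<open>Nondegeneracy of the pairing\<close>

lemma wedge_pd_zero [simp]: "wedge_pd L j (\<lambda>_. 0) \<beta> = 0" "wedge_pd L j \<alpha> (\<lambda>_. 0) = 0"
  by (simp_all add: wedge_pd_def)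

lemma wedge_dp_zero [simp]: "wedge_dp L m j \<beta> (\<lambda>_. 0) = 0"
  by (simp add: wedge_dp_def)

lemma zero_in_forms [simp]: "(\<lambda>_. 0) \<in> forms A"
  by (simp add: forms_def)

lemma wedge_pd_indicator:
  assumes "finite (simplices L j)" "S \<in> simplices L j"
  shows "wedge_pd L j (indicator {S}) \<beta> = \<beta> (dual_cell L S)"
proof -
  have "wedge_pd L j (indicator {S}) \<beta> = (\<Sum>T\<in>simplices L j. if T = S then \<beta> (dual_cell L T) else 0)"
    unfolding wedge_pd_def by (intro sum.cong) (auto simp: indicator_def)
  with assms show ?thesis by simp
qed

text \<open>Testing against the basis cochain of a simplex reads off the value on its dual cell, up
  to a nonzero sign.\<close>

lemma dual_form_eqI:
  assumes fin: "finite (simplices L j)"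
    and \<beta>: "\<beta> \<in> dual_forms L j" "\<beta>' \<in> dual_forms L j"
    and eq: "\<And>v. v \<in> primal_forms L j \<Longrightarrow> wedge_dp L m j \<beta> v = wedge_dp L m j \<beta>' v"
  shows "\<beta> = \<beta>'"
proof
  fix c
  show "\<beta> c = \<beta>' c"
  proof (cases "c \<in> dual_cell L ` simplices L j")
    case True
    then obtain S where S: "S \<in> simplices L j" "c = dual_cell L S" by blast
    then have "indicator {S} \<in> primal_forms L j"
      by (auto simp: forms_def indicator_def)
    from eq[OF this] show ?thesis
      using S fin by (simp add: wedge_dp_def wedge_pd_indicator)
  next
    case False
    with \<beta> show ?thesis by (simp add: forms_def)
  qed
qed

text \<open>The test forms are the indicators of dual cells; by injectivity each of them isolates
  one simplex.\<close>

lemma primal_form_eqI: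
  assumes fin: "finite (simplices L j)" and inj: "inj_on (dual_cell L) (simplices L j)"
    and \<alpha>: "\<alpha> \<in> primal_forms L j" "\<alpha>' \<in> primal_forms L j"
    and eq: "\<And>v. v \<in> dual_forms L j \<Longrightarrow> wedge_pd L j \<alpha> v = wedge_pd L j \<alpha>' v"
  shows "\<alpha> = \<alpha>'"
proof
  fix S
  show "\<alpha> S = \<alpha>' S"
  proof (cases "S \<in> simplices L j")
    case True
    have "wedge_pd L j \<gamma> (indicator {dual_cell L S}) = \<gamma> S" for \<gamma>
    proof -
      have "wedge_pd L j \<gamma> (indicator {dual_cell L S}) = (\<Sum>T\<in>simplices L j. if T = S then \<gamma> T else 0)"
        unfolding wedge_pd_def using True inj
        by (intro sum.cong) (auto simp: indicator_def inj_on_eq_iff)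
      with True fin show ?thesis by simp
    qed
    moreover have "indicator {dual_cell L S} \<in> dual_forms L j"
      using True by (auto simp: forms_def indicator_def)
    ultimately show ?thesis using eq by metis
  next
    case False
    with \<alpha> show ?thesis by (simp add: forms_def)
  qed
qed

text \<open>Vectors with a single nonzero component separate the three components of a covector.
  This gives the uniqueness of the adjoint.\<close>

lemma pairing_nondegenerate:
  assumes "finite (simplices K k)" "finite (simplices (boundary_complex n K) k)"
    and "inj_on (dual_cell K) (simplices K k)"
    and "e \<in> covectors K n k" "e' \<in> covectors K n k"
    and eq: "\<And>v. v \<in> phase_space K n k \<Longrightarrow> pairing K n k e v = pairing K n k e' v"
  shows "e = e'"
proof -
  obtain a b c a' b' c' where e: "e = (a, b, c)" "e' = (a', b', c')"
    by (metis prod_cases3)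
  have mem: "a \<in> dual_forms K k" "a' \<in> dual_forms K k" "b \<in> primal_forms K k" "b' \<in> primal_forms K k"
    "c \<in> dual_forms (boundary_complex n K) k" "c' \<in> dual_forms (boundary_complex n K) k"
    using assms(4,5) by (auto simp: covectors_def e)
  have "a = a'"
    using eq[of "(v, \<lambda>_. 0, \<lambda>_. 0)" for v]
    by (intro dual_form_eqI[OF assms(1) mem(1,2), where m = n])
      (simp add: phase_space_def pairing_def e)
  moreover have "b = b'"
    using eq[of "(\<lambda>_. 0, v, \<lambda>_. 0)" for v]
    by (intro primal_form_eqI[OF assms(1,3) mem(3,4)])
      (simp add: phase_space_def pairing_def e)
  moreover have "c = c'"
    using eq[of "(\<lambda>_. 0, \<lambda>_. 0, v)" for v]
    by (intro dual_form_eqI[OF assms(2) mem(5,6), where m = "n - 1"])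
      (simp add: phase_space_def pairing_def e)
  ultimately show ?thesis by (simp add: e)
qed

section \<open>Signs and the explicit adjoint\<close>

text \<open>On the left, the sign of exchanging factors in degree \<open>k\<close> meets the factor
  in the claimed adjoint; on the right, the exchange sign in degree \<open>k + 1\<close> meets the
  sign from summation by parts.\<close>

lemma adjoint_sign:
  assumes "k < n"
  shows "(-1::real) ^ (k * (n - k)) * (-1) ^ (n - k) = (-1) ^ (Suc k * (n - Suc k)) * (-1) ^ (k + 1)"
proof -
  obtain m where "n = Suc (k + m)"
    using assms less_imp_Suc_add by blast
  \<comment> \<open>Both total exponents equal \<open>(k + 1) * (n - k)\<close>.\<close>
  then have "k * (n - k) + (n - k) = Suc k * (n - Suc k) + (k + 1)"
    by (simp add: algebra_simps)
  then show ?thesis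
    by (metis power_add)
qed

text \<open>The quotient map is the identity on \<pi> and on the boundary component, so only the
  first covector component changes, by the transpose of the coboundary with its sign.\<close>

lemma cotangent_pi_G_eq:
  assumes K: "simplicial_complex K" and wc: "well_centered K" and kn: "k < n"
    and e: "e\<^sub>\<pi> \<in> primal_forms K k" "e\<^sub>b \<in> dual_forms (boundary_complex n K) k"
  shows "cotangent_pi_G K ori n k x (e\<^sub>\<rho>, e\<^sub>\<pi>, e\<^sub>b) =
    (\<lambda>c. (-1) ^ (n - k) * dual_d K ori k e\<^sub>\<rho> c, e\<^sub>\<pi>, e\<^sub>b)" (is "_ = ?e")
proof -
  note fin = finite_simplices[OF K] finite_boundary_simplices[OF K] inj_on_dual_cell[OF K wc]
  have mem: "?e \<in> covectors K n k"
    using e transpose_op_in_forms[of "simplices K k" "dual_cell K"]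
    by (simp add: covectors_def forms_def dual_d_def)
  have adj: "pairing K n k ?e v =
      reduced_pairing K n k (e\<^sub>\<rho>, e\<^sub>\<pi>, e\<^sub>b) (tangent_map (pi_G K ori k) x v)"
    if v: "v \<in> phase_space K n k" for v
  proof -
    obtain a b c where abc: "v = (a, b, c)" "a \<in> primal_forms K k"
      using v by (auto simp: phase_space_def)
    have "wedge_dp K n k (\<lambda>c. (-1) ^ (n - k) * dual_d K ori k e\<^sub>\<rho> c) a =
        ((-1) ^ (k * (n - k)) * (-1) ^ (n - k)) * wedge_pd K k a (dual_d K ori k e\<^sub>\<rho>)"
      by (simp add: wedge_dp_def wedge_pd_scale)
    also have "\<dots> = wedge_dp K n (Suc k) e\<^sub>\<rho> (coboundary K ori k a)"
      unfolding adjoint_sign[OF kn] wedge_dp_def wedge_pd_coboundary[OF fin(1,3) abc(2)]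
      by (simp only: mult.assoc)
    finally show ?thesis
      unfolding tangent_map_pi_G by (simp add: pi_G_def pairing_def reduced_pairing_def abc(1))
  qed
  show ?thesis
    unfolding cotangent_pi_G_def
  proof (rule the_equality)
    fix e'
    assume "e' \<in> covectors K n k \<and> (\<forall>v\<in>phase_space K n k. pairing K n k e' v =
      reduced_pairing K n k (e\<^sub>\<rho>, e\<^sub>\<pi>, e\<^sub>b) (tangent_map (pi_G K ori k) x v))"
    then show "e' = ?e"
      using adj mem by (intro pairing_nondegenerate[OF fin]) auto
  qed (use mem adj in blast)
qed

theorem theorem6p2:
  fixes K :: "'a::euclidean_space set set"
    and ori :: "'a set \<Rightarrow> 'a list"
    and n k :: nat
    and x :: "'a form3"
    and e\<^sub>\<rho> e\<^sub>\<pi> e\<^sub>b :: "'a form"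
  assumes "simplicial_complex K"
    and "manifold_like n K"
    and "well_centered K"
    and "oriented n K ori"
    and "k < n"
    and "x \<in> phase_space K n k"
    and "e\<^sub>\<rho> \<in> dual_forms K (Suc k)"
    and "e\<^sub>\<pi> \<in> primal_forms K k"
    and "e\<^sub>b \<in> dual_forms (boundary_complex n K) k"
  shows "reduced_sharp K ori n k x (e\<^sub>\<rho>, e\<^sub>\<pi>, e\<^sub>b) =
    (coboundary K ori k e\<^sub>\<pi>,
     \<lambda>c. - ((-1) ^ (k * (n - k)) *
            ((-1) ^ (n - k) * dual_d K ori k e\<^sub>\<rho> c + boundary_d K n k e\<^sub>b c)),
     \<lambda>c. - bd_trace K n k e\<^sub>\<pi> c)"
  \<comment> \<open>With the adjoint known, \<open>sharp\<close> is applied to it, and the tangent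
    map then takes the coboundary of the first component.\<close>
  by (simp add: reduced_sharp_def cotangent_pi_G_eq[OF assms(1,3,5,8,9)] sharp_def
      tangent_map_pi_G) (simp add: pi_G_def)

end
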